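(* Let $F\colon\mathcal A\to\mathcal B$ be left adjoint to $U\colon\mathcal B\to\mathcal A$, with unit $\eta\colon \mathrm{id}\to UF$ and counit $\epsilon\colon FU\to\mathrm{id}$; let $\mathbb B=(B,\mu,\eta)$, $B=UF$, $\mu=U\epsilon F$, be the induced monad on $\mathcal A$ and $\mathbb T=(T,\Delta,\epsilon)$, $T=FU$, $\Delta=F\eta U$, the induced comonad on $\mathcal B$. Let $S\colon\mathcal B\to\mathcal B$ and $C\colon\mathcal A\to\mathcal A$ be endofunctors and $\Omega\colon CU\to US$ a natural isomorphism. Let $\Lambda\colon FC\to SF$ be the natural transformation corresponding under the adjunction to $\Omega F\circ C\eta\colon C\to USF$. Then: (1) The natural transformation $\theta:=\Omega^{-1}F\circ U\Lambda\colon BC=UFC\to CUF=CB$ is a lax endomorphism of the monad $\mathbb B$. (2) The natural transformation $\chi:=\Lambda U\circ F\Omega^{-1}\colon TS=FUS\to SFU=ST$ is a lax endomorphism of the comonad $\mathbb T$. (3) $\theta$ is the unique lax endomorphism $BC\to CB$ of $\mathbb B$ such that $$CU\epsilon\circ\theta U=\Omega^{-1}\circ U\epsilon S\circ UF\Omega\colon UFCU\to CU.$$ (4) $\chi$ is the unique lax endomorphism $TS\to ST$ of $\mathbb T$ such that $$U\chi\circ\eta US=\Omega FU\circ C\eta U\circ\Omega^{-1}\colon US\to USFU.$$ (5) If $C$ is part of a comonad $\mathbb C=(C,\Delta^C,\varepsilon^C)$, $S$ is part of a comonad $\mathbb S=(S,\Delta^S,\varepsilon^S)$, and $\Omega$ is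 a lax morphism of comonads, then $\theta$ is a mixed distributive law between $\mathbb B$ and $\mathbb C$ and $\chi$ is a comonad distributive law between $\mathbb T$ and $\mathbb S$.
   Context: Juxtaposition denotes composition of functors and whiskering of natural transformations. A lax endomorphism of the monad $\mathbb B$ (over the functor $C$) is a natural transformation $\theta\colon BC\to CB$ with $\theta\circ\eta C=C\eta$ and $\theta\circ\mu C=C\mu\circ\theta B\circ B\theta$. A lax endomorphism of the comonad $\mathbb T$ (over the functor $S$) is a natural transformation $\chi\colon TS\to ST$ with $S\epsilon\circ\chi=\epsilon S$ and $S\Delta\circ\chi=\chi T\circ T\chi\circ\Delta S$. $\Omega\colon CU\to US$ is a lax morphism of comonads if $U\varepsilon^S\circ\Omega=\varepsilon^CU$ and $U\Delta^S\circ\Omega=\Omega S\circ C\Omega\circ\Delta^CU$. A mixed distributive law between $\mathbb B$ and $\mathbb C$ is a natural transformation $\theta\colon BC\to CB$ that is a lax endomorphism of the monad $\mathbb B$ over the functor $C$, i.e. satisfies $\theta\circ\eta C=C\eta$ and $\theta\circ\mu C=C\mu\circ\theta B\circ B\theta$, and also satisfies $\varepsilon^CB\circ\theta=B\varepsilon^C$ and $\Delta^CB\circ\theta=C\theta\circ\theta C\circ B\Delta^C$. A comonad distributive law $\chi\colon\mathbb T\mathbb S\to\mathbb S\mathbb T$ is a natural transformation $\chi\colon TS\to ST$ that is a lax endomorphism of the comonad $\mathbb T$ over the functor $S$, i.e. satisfies $S\epsilon\circ\chi=\epsilon S$ and $S\Delta\circ\chi=\chi T\circ T\chi\circ\Delta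 S$, and also satisfies $\varepsilon^ST\circ\chi=T\varepsilon^S$ and $\Delta^ST\circ\chi=S\chi\circ\chi S\circ T\Delta^S$. *)

theory Defs
  imports Main
begin

section \<open>Categories, functors, natural transformations\<close>

text \<open>
  Objects and arrows live in carrier sets, so functors and natural transformations are
  meaningful only on these carriers. Accordingly natural transformations are compared by
  \<open>nt_eq\<close>, i.e. by their components at the objects of the source category.
\<close>

record ('o, 'm) cat =
  Obj :: "'o set"
  Arr :: "'m set"
  Dom :: "'m \<Rightarrow> 'o"
  Cod :: "'m \<Rightarrow> 'o"
  Ide :: "'o \<Rightarrow> 'm"
  Comp :: "'m \<Rightarrow> 'm \<Rightarrow> 'm" (infixl "\<cdot>\<index>" 70)

definition Hom :: "('o, 'm) cat \<Rightarrow> 'o \<Rightarrow> 'o \<Rightarrow> 'm set" where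
  "Hom A X Y = {f \<in> Arr A. Dom A f = X \<and> Cod A f = Y}"

locale category =
  fixes A :: "('o, 'm) cat" (structure)
  assumes Dom_Obj: "f \<in> Arr A \<Longrightarrow> Dom A f \<in> Obj A"
    and Cod_Obj: "f \<in> Arr A \<Longrightarrow> Cod A f \<in> Obj A"
    and Ide_Hom: "X \<in> Obj A \<Longrightarrow> Ide A X \<in> Hom A X X"
    and Comp_Hom: "\<lbrakk>f \<in> Hom A X Y; g \<in> Hom A Y Z\<rbrakk> \<Longrightarrow> g \<cdot> f \<in> Hom A X Z"
    and Comp_Ide_left: "f \<in> Hom A X Y \<Longrightarrow> Ide A Y \<cdot> f = f"
    and Comp_Ide_right: "f \<in> Hom A X Y \<Longrightarrow> f \<cdot> Ide A X = f"
    and Comp_assoc: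
      "\<lbrakk>f \<in> Hom A W X; g \<in> Hom A X Y; h \<in> Hom A Y Z\<rbrakk> \<Longrightarrow> h \<cdot> g \<cdot> f = h \<cdot> (g \<cdot> f)"

definition inverse_arrows :: "('o, 'm) cat \<Rightarrow> 'm \<Rightarrow> 'm \<Rightarrow> bool" where
  "inverse_arrows A f g \<longleftrightarrow>
     f \<in> Arr A \<and> g \<in> Hom A (Cod A f) (Dom A f) \<and>
     g \<cdot>\<^bsub>A\<^esub> f = Ide A (Dom A f) \<and> f \<cdot>\<^bsub>A\<^esub> g = Ide A (Cod A f)"

definition is_iso :: "('o, 'm) cat \<Rightarrow> 'm \<Rightarrow> bool" where
  "is_iso A f \<longleftrightarrow> (\<exists>g. inverse_arrows A f g)"

definition inverse_arrow :: "('o, 'm) cat \<Rightarrow> 'm \<Rightarrow> 'm" where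
  "inverse_arrow A f = (THE g. inverse_arrows A f g)"

record ('o1, 'm1, 'o2, 'm2) func =
  omap :: "'o1 \<Rightarrow> 'o2"
  amap :: "'m1 \<Rightarrow> 'm2"

locale cat_functor = source: category A + target: category B
  for A :: "('o1, 'm1) cat" and B :: "('o2, 'm2) cat"
    and F :: "('o1, 'm1, 'o2, 'm2) func" +
  assumes omap_Obj: "X \<in> Obj A \<Longrightarrow> omap F X \<in> Obj B"
    and amap_Hom: "f \<in> Hom A X Y \<Longrightarrow> amap F f \<in> Hom B (omap F X) (omap F Y)"
    and amap_Ide: "X \<in> Obj A \<Longrightarrow> amap F (Ide A X) = Ide B (omap F X)"
    and amap_Comp: "\<lbrakk>f \<in> Hom A X Y; g \<in> Hom A Y Z\<rbrakk> \<Longrightarrow>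
      amap F (g \<cdot>\<^bsub>A\<^esub> f) = amap F g \<cdot>\<^bsub>B\<^esub> amap F f"

definition id_func :: "('o, 'm, 'o, 'm) func" where
  "id_func = \<lparr>omap = id, amap = id\<rparr>"

definition comp_func ::
  "('o2, 'm2, 'o3, 'm3) func \<Rightarrow> ('o1, 'm1, 'o2, 'm2) func \<Rightarrow> ('o1, 'm1, 'o3, 'm3) func"
  (infixl "\<star>" 80) where
  "G \<star> F = \<lparr>omap = omap G \<circ> omap F, amap = amap G \<circ> amap F\<rparr>"

text \<open>A transformation between functors from \<open>A\<close> to \<open>B\<close> is its family of components.\<close>

locale natural_transformation =
  dom_functor: cat_functor A B F + cod_functor: cat_functor A B G
  for A :: "('o1, 'm1) cat" and B :: "('o2, 'm2) cat"
    and F G :: "('o1, 'm1, 'o2, 'm2) func" and \<tau> :: "'o1 \<Rightarrow> 'm2" +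
  assumes component_Hom: "X \<in> Obj A \<Longrightarrow> \<tau> X \<in> Hom B (omap F X) (omap G X)"
    and naturality: "f \<in> Hom A X Y \<Longrightarrow>
      \<tau> Y \<cdot>\<^bsub>B\<^esub> amap F f = amap G f \<cdot>\<^bsub>B\<^esub> \<tau> X"

locale natural_isomorphism = natural_transformation +
  assumes component_iso: "X \<in> Obj A \<Longrightarrow> is_iso B (\<tau> X)"

definition nt_eq :: "('o1, 'm1) cat \<Rightarrow> ('o1 \<Rightarrow> 'm2) \<Rightarrow> ('o1 \<Rightarrow> 'm2) \<Rightarrow> bool"
  (infix "\<doteq>\<index>" 50) where
  "nt_eq A \<sigma> \<tau> \<longleftrightarrow> (\<forall>X\<in>Obj A. \<sigma> X = \<tau> X)"

definition nt_id :: "('o2, 'm2) cat \<Rightarrow> ('o1, 'm1, 'o2, 'm2) func \<Rightarrow> 'o1 \<Rightarrow> 'm2" where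
  "nt_id B F = (\<lambda>X. Ide B (omap F X))"

text \<open>Vertical composition; the index is the target category of the functors.\<close>

definition nt_comp :: "('o2, 'm2) cat \<Rightarrow> ('o1 \<Rightarrow> 'm2) \<Rightarrow> ('o1 \<Rightarrow> 'm2) \<Rightarrow> 'o1 \<Rightarrow> 'm2"
  (infixl "\<bullet>\<index>" 70) where
  "nt_comp B \<sigma> \<tau> = (\<lambda>X. \<sigma> X \<cdot>\<^bsub>B\<^esub> \<tau> X)"

definition nt_inv :: "('o2, 'm2) cat \<Rightarrow> ('o1 \<Rightarrow> 'm2) \<Rightarrow> 'o1 \<Rightarrow> 'm2" where
  "nt_inv B \<tau> = (\<lambda>X. inverse_arrow B (\<tau> X))"

text \<open>Whiskering: \<open>G \<triangleright> \<tau>\<close> is \<open>G\<tau>\<close> and \<open>\<tau> \<triangleleft> H\<close> is \<open>\<tau>H\<close>.\<close>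

definition whisker_left ::
  "('o2, 'm2, 'o3, 'm3) func \<Rightarrow> ('o1 \<Rightarrow> 'm2) \<Rightarrow> 'o1 \<Rightarrow> 'm3" (infixr "\<triangleright>" 75) where
  "G \<triangleright> \<tau> = (\<lambda>X. amap G (\<tau> X))"

definition whisker_right ::
  "('o1 \<Rightarrow> 'm2) \<Rightarrow> ('o0, 'm0, 'o1, 'm1) func \<Rightarrow> 'o0 \<Rightarrow> 'm2" (infixl "\<triangleleft>" 76) where
  "\<tau> \<triangleleft> H = (\<lambda>X. \<tau> (omap H X))"

section \<open>Monads, comonads, adjunctions\<close>

locale monad = endo: cat_functor A A M +
    mult: natural_transformation A A "M \<star> M" M \<mu> +
    unit: natural_transformation A A id_func M \<eta>
  for A :: "('o, 'm) cat" and M :: "('o, 'm, 'o, 'm) func" and \<mu> \<eta> :: "'o \<Rightarrow> 'm" +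
  assumes mult_assoc: "\<mu> \<bullet>\<^bsub>A\<^esub> (M \<triangleright> \<mu>) \<doteq>\<^bsub>A\<^esub> \<mu> \<bullet>\<^bsub>A\<^esub> (\<mu> \<triangleleft> M)"
    and unit_left: "\<mu> \<bullet>\<^bsub>A\<^esub> (\<eta> \<triangleleft> M) \<doteq>\<^bsub>A\<^esub> nt_id A M"
    and unit_right: "\<mu> \<bullet>\<^bsub>A\<^esub> (M \<triangleright> \<eta>) \<doteq>\<^bsub>A\<^esub> nt_id A M"

locale comonad = endo: cat_functor A A W +
    comult: natural_transformation A A W "W \<star> W" \<Delta> +
    counit: natural_transformation A A W id_func \<epsilon>
  for A :: "('o, 'm) cat" and W :: "('o, 'm, 'o, 'm) func" and \<Delta> \<epsilon> :: "'o \<Rightarrow> 'm" +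
  assumes comult_coassoc: "(W \<triangleright> \<Delta>) \<bullet>\<^bsub>A\<^esub> \<Delta> \<doteq>\<^bsub>A\<^esub> (\<Delta> \<triangleleft> W) \<bullet>\<^bsub>A\<^esub> \<Delta>"
    and counit_left: "(\<epsilon> \<triangleleft> W) \<bullet>\<^bsub>A\<^esub> \<Delta> \<doteq>\<^bsub>A\<^esub> nt_id A W"
    and counit_right: "(W \<triangleright> \<epsilon>) \<bullet>\<^bsub>A\<^esub> \<Delta> \<doteq>\<^bsub>A\<^esub> nt_id A W"

locale adjunction = left: cat_functor A B F + right: cat_functor B A U +
    unit: natural_transformation A A id_func "U \<star> F" \<eta> +
    counit: natural_transformation B B "F \<star> U" id_func \<epsilon>
  for A :: "('oa, 'ma) cat" and B :: "('ob, 'mb) cat"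
    and F :: "('oa, 'ma, 'ob, 'mb) func" and U :: "('ob, 'mb, 'oa, 'ma) func"
    and \<eta> :: "'oa \<Rightarrow> 'ma" and \<epsilon> :: "'ob \<Rightarrow> 'mb" +
  assumes triangle_left: "(\<epsilon> \<triangleleft> F) \<bullet>\<^bsub>B\<^esub> (F \<triangleright> \<eta>) \<doteq>\<^bsub>A\<^esub> nt_id B F"
    and triangle_right: "(U \<triangleright> \<epsilon>) \<bullet>\<^bsub>A\<^esub> (\<eta> \<triangleleft> U) \<doteq>\<^bsub>B\<^esub> nt_id A U"

text \<open>
  For \<open>\<tau>: H \<rightarrow> UG\<close>, with \<open>F\<close> left adjoint to \<open>U\<close> and counit \<open>\<epsilon>\<close>, this is the transformation
  \<open>FH \<rightarrow> G\<close> corresponding to \<open>\<tau>\<close> under the adjunction. That it is the unique \<open>\<lambda>\<close> with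
  \<open>U\<lambda> \<circ> \<eta>H = \<tau>\<close> is \<open>adjunction.left_transpose_correct\<close> below.
\<close>

definition left_transpose ::
  "('ob, 'mb) cat \<Rightarrow> ('oa, 'ma, 'ob, 'mb) func \<Rightarrow> ('ob \<Rightarrow> 'mb) \<Rightarrow>
   ('ox, 'mx, 'ob, 'mb) func \<Rightarrow> ('ox \<Rightarrow> 'ma) \<Rightarrow> 'ox \<Rightarrow> 'mb" where
  "left_transpose B F \<epsilon> G \<tau> = (\<epsilon> \<triangleleft> G) \<bullet>\<^bsub>B\<^esub> (F \<triangleright> \<tau>)"

lemma (in adjunction) left_transpose_correct:
  assumes "natural_transformation X A H (U \<star> G) \<tau>" and "cat_functor X B G"
  shows "natural_transformation X B (F \<star> H) G (left_transpose B F \<epsilon> G \<tau>)" (is ?nat)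
    and "(U \<triangleright> left_transpose B F \<epsilon> G \<tau>) \<bullet>\<^bsub>A\<^esub> (\<eta> \<triangleleft> H) \<doteq>\<^bsub>X\<^esub> \<tau>" (is ?eq)
    and "\<lbrakk>natural_transformation X B (F \<star> H) G \<kappa>;
          (U \<triangleright> \<kappa>) \<bullet>\<^bsub>A\<^esub> (\<eta> \<triangleleft> H) \<doteq>\<^bsub>X\<^esub> \<tau>\<rbrakk> \<Longrightarrow>
         \<kappa> \<doteq>\<^bsub>X\<^esub> left_transpose B F \<epsilon> G \<tau>"
proof -
  interpret tau: natural_transformation X A H "U \<star> G" \<tau> by (fact assms(1))
  interpret G: cat_functor X B G by (fact assms(2))
  let ?l = "left_transpose B F \<epsilon> G \<tau>"
  have l: "?l Z = \<epsilon> (omap G Z) \<cdot>\<^bsub>B\<^esub> amap F (\<tau> Z)" for Z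
    by (simp add: left_transpose_def nt_comp_def whisker_left_def whisker_right_def)
  have obj: "Y \<in> Obj X \<and> Z \<in> Obj X" if "f \<in> Hom X Y Z" for f Y Z
    using that tau.dom_functor.source.Dom_Obj tau.dom_functor.source.Cod_Obj by (auto simp: Hom_def)
  have \<tau>: "\<tau> Z \<in> Hom A (omap H Z) (omap U (omap G Z))" if "Z \<in> Obj X" for Z
    using tau.component_Hom[OF that] by (simp add: comp_func_def)
  have \<epsilon>: "\<epsilon> Y \<in> Hom B (omap F (omap U Y)) Y" if "Y \<in> Obj B" for Y
    using counit.component_Hom[OF that] by (simp add: comp_func_def id_func_def)
  have \<eta>: "\<eta> Y \<in> Hom A Y (omap U (omap F Y))" if "Y \<in> Obj A" for Y
    using unit.component_Hom[OF that] by (simp add: comp_func_def id_func_def)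
  have natl: "?l Z \<cdot>\<^bsub>B\<^esub> amap F (amap H f) = amap G f \<cdot>\<^bsub>B\<^esub> ?l Y" if f: "f \<in> Hom X Y Z" for f Y Z
  proof -
    have YZ: "Y \<in> Obj X" "Z \<in> Obj X" using obj[OF f] by auto
    note Hf = tau.dom_functor.amap_Hom[OF f] and Gf = G.amap_Hom[OF f]
    note GY = G.omap_Obj[OF YZ(1)] and GZ = G.omap_Obj[OF YZ(2)]
    have "?l Z \<cdot>\<^bsub>B\<^esub> amap F (amap H f)
        = \<epsilon> (omap G Z) \<cdot>\<^bsub>B\<^esub> (amap F (\<tau> Z) \<cdot>\<^bsub>B\<^esub> amap F (amap H f))"
      unfolding l
      by (rule left.target.Comp_assoc[OF left.amap_Hom[OF Hf] left.amap_Hom[OF \<tau>[OF YZ(2)]] \<epsilon>[OF GZ]])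
    also have "\<dots> = \<epsilon> (omap G Z) \<cdot>\<^bsub>B\<^esub> amap F (\<tau> Z \<cdot>\<^bsub>A\<^esub> amap H f)"
      by (simp add: left.amap_Comp[OF Hf \<tau>[OF YZ(2)]])
    also have "\<dots> = \<epsilon> (omap G Z) \<cdot>\<^bsub>B\<^esub> amap F (amap U (amap G f) \<cdot>\<^bsub>A\<^esub> \<tau> Y)"
      using tau.naturality[OF f] by (simp add: comp_func_def)
    also have "\<dots> = \<epsilon> (omap G Z) \<cdot>\<^bsub>B\<^esub> (amap F (amap U (amap G f)) \<cdot>\<^bsub>B\<^esub> amap F (\<tau> Y))"
      by (simp add: left.amap_Comp[OF \<tau>[OF YZ(1)] right.amap_Hom[OF Gf]])
    also have "\<dots> = \<epsilon> (omap G Z) \<cdot>\<^bsub>B\<^esub> amap F (amap U (amap G f)) \<cdot>\<^bsub>B\<^esub> amap F (\<tau> Y)"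
      by (rule left.target.Comp_assoc[OF left.amap_Hom[OF \<tau>[OF YZ(1)]]
            left.amap_Hom[OF right.amap_Hom[OF Gf]] \<epsilon>[OF GZ], symmetric])
    also have "\<dots> = amap G f \<cdot>\<^bsub>B\<^esub> \<epsilon> (omap G Y) \<cdot>\<^bsub>B\<^esub> amap F (\<tau> Y)"
      using counit.naturality[OF Gf] by (simp add: comp_func_def id_func_def)
    also have "\<dots> = amap G f \<cdot>\<^bsub>B\<^esub> ?l Y"
      unfolding l by (rule left.target.Comp_assoc[OF left.amap_Hom[OF \<tau>[OF YZ(1)]] \<epsilon>[OF GY] Gf])
    finally show ?thesis .
  qed
  have FH: "cat_functor X B (F \<star> H)"
    by unfold_locales
      (auto simp: comp_func_def left.amap_Ide[OF tau.dom_functor.omap_Obj]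
         left.amap_Comp[OF tau.dom_functor.amap_Hom tau.dom_functor.amap_Hom]
         tau.dom_functor.amap_Ide tau.dom_functor.amap_Comp
       intro: left.omap_Obj tau.dom_functor.omap_Obj left.amap_Hom tau.dom_functor.amap_Hom)
  interpret FH: cat_functor X B "F \<star> H" by (fact FH)
  show ?nat
  proof unfold_locales
    fix Z assume Z: "Z \<in> Obj X"
    show "?l Z \<in> Hom B (omap (F \<star> H) Z) (omap G Z)"
      unfolding l using left.target.Comp_Hom[OF left.amap_Hom[OF \<tau>[OF Z]] \<epsilon>[OF G.omap_Obj[OF Z]]]
      by (simp add: comp_func_def)
  next
    fix f Y Z assume "f \<in> Hom X Y Z"
    from natl[OF this] show "?l Z \<cdot>\<^bsub>B\<^esub> amap (F \<star> H) f = amap G f \<cdot>\<^bsub>B\<^esub> ?l Y"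
      by (simp add: comp_func_def)
  qed
  show ?eq
    unfolding nt_eq_def
  proof
    fix Z assume Z: "Z \<in> Obj X"
    note GZ = G.omap_Obj[OF Z] and HZ = tau.dom_functor.omap_Obj[OF Z] and t = \<tau>[OF Z]
    note UGZ = right.omap_Obj[OF GZ]
    have "amap U (?l Z) \<cdot>\<^bsub>A\<^esub> \<eta> (omap H Z)
        = amap U (\<epsilon> (omap G Z)) \<cdot>\<^bsub>A\<^esub> amap U (amap F (\<tau> Z)) \<cdot>\<^bsub>A\<^esub> \<eta> (omap H Z)"
      unfolding l by (simp add: right.amap_Comp[OF left.amap_Hom[OF t] \<epsilon>[OF GZ]])
    also have "\<dots> = amap U (\<epsilon> (omap G Z)) \<cdot>\<^bsub>A\<^esub> (amap U (amap F (\<tau> Z)) \<cdot>\<^bsub>A\<^esub> \<eta> (omap H Z))"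
      by (rule left.source.Comp_assoc[OF \<eta>[OF HZ] right.amap_Hom[OF left.amap_Hom[OF t]]
            right.amap_Hom[OF \<epsilon>[OF GZ]]])
    also have "\<dots> = amap U (\<epsilon> (omap G Z)) \<cdot>\<^bsub>A\<^esub> (\<eta> (omap U (omap G Z)) \<cdot>\<^bsub>A\<^esub> \<tau> Z)"
      using unit.naturality[OF t] by (simp add: comp_func_def id_func_def)
    also have "\<dots> = amap U (\<epsilon> (omap G Z)) \<cdot>\<^bsub>A\<^esub> \<eta> (omap U (omap G Z)) \<cdot>\<^bsub>A\<^esub> \<tau> Z"
      by (rule left.source.Comp_assoc[OF t \<eta>[OF UGZ] right.amap_Hom[OF \<epsilon>[OF GZ]], symmetric])
    also have "\<dots> = \<tau> Z"
      using triangle_right GZ left.source.Comp_Ide_left[OF t]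
      by (simp add: nt_eq_def nt_comp_def whisker_left_def whisker_right_def nt_id_def)
    finally show "((U \<triangleright> ?l) \<bullet>\<^bsub>A\<^esub> (\<eta> \<triangleleft> H)) Z = \<tau> Z"
      by (simp add: nt_comp_def whisker_left_def whisker_right_def)
  qed
  show "\<kappa> \<doteq>\<^bsub>X\<^esub> ?l"
    if k: "natural_transformation X B (F \<star> H) G \<kappa>"
      and eq: "(U \<triangleright> \<kappa>) \<bullet>\<^bsub>A\<^esub> (\<eta> \<triangleleft> H) \<doteq>\<^bsub>X\<^esub> \<tau>"
    unfolding nt_eq_def
  proof
    interpret k: natural_transformation X B "F \<star> H" G \<kappa> by (fact k)
    fix Z assume Z: "Z \<in> Obj X"
    note GZ = G.omap_Obj[OF Z] and HZ = tau.dom_functor.omap_Obj[OF Z]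
    note FHZ = left.omap_Obj[OF HZ]
    have k: "\<kappa> Z \<in> Hom B (omap F (omap H Z)) (omap G Z)"
      using k.component_Hom[OF Z] by (simp add: comp_func_def)
    have "\<tau> Z = amap U (\<kappa> Z) \<cdot>\<^bsub>A\<^esub> \<eta> (omap H Z)"
      using eq Z by (simp add: nt_eq_def nt_comp_def whisker_left_def whisker_right_def)
    then have "?l Z = \<epsilon> (omap G Z) \<cdot>\<^bsub>B\<^esub> (amap F (amap U (\<kappa> Z)) \<cdot>\<^bsub>B\<^esub> amap F (\<eta> (omap H Z)))"
      unfolding l by (simp add: left.amap_Comp[OF \<eta>[OF HZ] right.amap_Hom[OF k]])
    also have "\<dots> = \<epsilon> (omap G Z) \<cdot>\<^bsub>B\<^esub> amap F (amap U (\<kappa> Z)) \<cdot>\<^bsub>B\<^esub> amap F (\<eta> (omap H Z))"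
      by (rule left.target.Comp_assoc[OF left.amap_Hom[OF \<eta>[OF HZ]]
            left.amap_Hom[OF right.amap_Hom[OF k]] \<epsilon>[OF GZ], symmetric])
    also have "\<dots> = \<kappa> Z \<cdot>\<^bsub>B\<^esub> \<epsilon> (omap F (omap H Z)) \<cdot>\<^bsub>B\<^esub> amap F (\<eta> (omap H Z))"
      using counit.naturality[OF k] by (simp add: comp_func_def id_func_def)
    also have "\<dots> = \<kappa> Z \<cdot>\<^bsub>B\<^esub> (\<epsilon> (omap F (omap H Z)) \<cdot>\<^bsub>B\<^esub> amap F (\<eta> (omap H Z)))"
      by (rule left.target.Comp_assoc[OF left.amap_Hom[OF \<eta>[OF HZ]] \<epsilon>[OF FHZ] k])
    also have "\<dots> = \<kappa> Z"
      using triangle_left HZ left.target.Comp_Ide_right[OF k]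
      by (simp add: nt_eq_def nt_comp_def whisker_left_def whisker_right_def nt_id_def)
    finally show "\<kappa> Z = ?l Z" by simp
  qed
qed

section \<open>Lax endomorphisms and distributive laws\<close>

locale lax_monad_endomorphism = monad A M \<mu> \<eta> + over: cat_functor A A C +
    trans: natural_transformation A A "M \<star> C" "C \<star> M" \<theta>
  for A :: "('o, 'm) cat" and M :: "('o, 'm, 'o, 'm) func" and \<mu> \<eta> :: "'o \<Rightarrow> 'm"
    and C :: "('o, 'm, 'o, 'm) func" and \<theta> :: "'o \<Rightarrow> 'm" +
  assumes lax_unit: "\<theta> \<bullet>\<^bsub>A\<^esub> (\<eta> \<triangleleft> C) \<doteq>\<^bsub>A\<^esub> C \<triangleright> \<eta>"
    and lax_mult: "\<theta> \<bullet>\<^bsub>A\<^esub> (\<mu> \<triangleleft> C) \<doteq>\<^bsub>A\<^esub> (C \<triangleright> \<mu>) \<bullet>\<^bsub>A\<^esub> (\<theta> \<triangleleft> M) \<bullet>\<^bsub>A\<^esub> (M \<triangleright> \<theta>)"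

locale lax_comonad_endomorphism = comonad B T \<Delta> \<epsilon> + over: cat_functor B B S +
    trans: natural_transformation B B "T \<star> S" "S \<star> T" \<chi>
  for B :: "('o, 'm) cat" and T :: "('o, 'm, 'o, 'm) func" and \<Delta> \<epsilon> :: "'o \<Rightarrow> 'm"
    and S :: "('o, 'm, 'o, 'm) func" and \<chi> :: "'o \<Rightarrow> 'm" +
  assumes lax_counit: "(S \<triangleright> \<epsilon>) \<bullet>\<^bsub>B\<^esub> \<chi> \<doteq>\<^bsub>B\<^esub> \<epsilon> \<triangleleft> S"
    and lax_comult: "(S \<triangleright> \<Delta>) \<bullet>\<^bsub>B\<^esub> \<chi> \<doteq>\<^bsub>B\<^esub> (\<chi> \<triangleleft> T) \<bullet>\<^bsub>B\<^esub> (T \<triangleright> \<chi>) \<bullet>\<^bsub>B\<^esub> (\<Delta> \<triangleleft> S)"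

locale lax_comonad_morphism =
    source: comonad A C \<Delta>C \<epsilon>C + target: comonad B S \<Delta>S \<epsilon>S +
    along: cat_functor B A U + trans: natural_transformation B A "C \<star> U" "U \<star> S" \<Omega>
  for A :: "('oa, 'ma) cat" and C :: "('oa, 'ma, 'oa, 'ma) func" and \<Delta>C \<epsilon>C :: "'oa \<Rightarrow> 'ma"
    and B :: "('ob, 'mb) cat" and S :: "('ob, 'mb, 'ob, 'mb) func" and \<Delta>S \<epsilon>S :: "'ob \<Rightarrow> 'mb"
    and U :: "('ob, 'mb, 'oa, 'ma) func" and \<Omega> :: "'ob \<Rightarrow> 'ma" +
  assumes morphism_counit: "(U \<triangleright> \<epsilon>S) \<bullet>\<^bsub>A\<^esub> \<Omega> \<doteq>\<^bsub>B\<^esub> \<epsilon>C \<triangleleft> U"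
    and morphism_comult:
      "(U \<triangleright> \<Delta>S) \<bullet>\<^bsub>A\<^esub> \<Omega> \<doteq>\<^bsub>B\<^esub> (\<Omega> \<triangleleft> S) \<bullet>\<^bsub>A\<^esub> (C \<triangleright> \<Omega>) \<bullet>\<^bsub>A\<^esub> (\<Delta>C \<triangleleft> U)"

locale mixed_distributive_law =
    lax_monad_endomorphism A M \<mu> \<eta> C \<theta> + over_comonad: comonad A C \<Delta>C \<epsilon>C
  for A :: "('o, 'm) cat" and M :: "('o, 'm, 'o, 'm) func" and \<mu> \<eta> :: "'o \<Rightarrow> 'm"
    and C :: "('o, 'm, 'o, 'm) func" and \<Delta>C \<epsilon>C :: "'o \<Rightarrow> 'm" and \<theta> :: "'o \<Rightarrow> 'm" +
  assumes mixed_counit: "(\<epsilon>C \<triangleleft> M) \<bullet>\<^bsub>A\<^esub> \<theta> \<doteq>\<^bsub>A\<^esub> M \<triangleright> \<epsilon>C"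
    and mixed_comult:
      "(\<Delta>C \<triangleleft> M) \<bullet>\<^bsub>A\<^esub> \<theta> \<doteq>\<^bsub>A\<^esub> (C \<triangleright> \<theta>) \<bullet>\<^bsub>A\<^esub> (\<theta> \<triangleleft> C) \<bullet>\<^bsub>A\<^esub> (M \<triangleright> \<Delta>C)"

locale comonad_distributive_law =
    lax_comonad_endomorphism B T \<Delta> \<epsilon> S \<chi> + over_comonad: comonad B S \<Delta>S \<epsilon>S
  for B :: "('o, 'm) cat" and T :: "('o, 'm, 'o, 'm) func" and \<Delta> \<epsilon> :: "'o \<Rightarrow> 'm"
    and S :: "('o, 'm, 'o, 'm) func" and \<Delta>S \<epsilon>S :: "'o \<Rightarrow> 'm" and \<chi> :: "'o \<Rightarrow> 'm" +
  assumes distrib_counit: "(\<epsilon>S \<triangleleft> T) \<bullet>\<^bsub>B\<^esub> \<chi> \<doteq>\<^bsub>B\<^esub> T \<triangleright> \<epsilon>S"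
    and distrib_comult:
      "(\<Delta>S \<triangleleft> T) \<bullet>\<^bsub>B\<^esub> \<chi> \<doteq>\<^bsub>B\<^esub> (S \<triangleright> \<chi>) \<bullet>\<^bsub>B\<^esub> (\<chi> \<triangleleft> S) \<bullet>\<^bsub>B\<^esub> (T \<triangleright> \<Delta>S)"

end

theory Submission
  imports Defs
begin

text \<open>
  Everything is computed on components. By the adjunction, an arrow \<open>f\<close> out of \<open>F X\<close> is
  determined by \<open>U f \<circ> \<eta>\<close>; this gives the identity \<open>S\<epsilon> \<circ> \<Lambda>U = \<epsilon>S \<circ> F\<Omega>\<close> and, when \<open>\<Omega>\<close> is a lax
  morphism of comonads, the identities \<open>\<epsilon>\<^sup>SF \<circ> \<Lambda> = F\<epsilon>\<^sup>C\<close> and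
  \<open>\<Delta>\<^sup>SF \<circ> \<Lambda> = S\<Lambda> \<circ> \<Lambda>C \<circ> F\<Delta>\<^sup>C\<close>. All axioms for \<open>\<theta>\<close> and \<open>\<chi>\<close> follow from these by naturality.
  For uniqueness, the triangle identity and naturality recover \<open>\<theta>\<close> as
  \<open>CU\<epsilon>F \<circ> \<theta>UF \<circ> UFC\<eta>\<close>, and the adjunction recovers \<open>\<chi>\<close> from \<open>U\<chi> \<circ> \<eta>US\<close>.
\<close>

section \<open>Components and carriers\<close>

lemma comp_func_apply [simp]:
  "omap (G \<star> F) X = omap G (omap F X)" "amap (G \<star> F) f = amap G (amap F f)"
  by (simp_all add: comp_func_def)

lemma id_func_apply [simp]: "omap id_func X = X" "amap id_func f = f"
  by (simp_all add: id_func_def)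

lemma comp_func_id [simp]: "F \<star> id_func = F"
  by (simp add: comp_func_def id_func_def)

lemma comp_func_assoc: "H \<star> G \<star> F = H \<star> (G \<star> F)"
  by (simp add: comp_func_def comp_assoc)

lemma nt_comp_apply [simp]: "(\<sigma> \<bullet>\<^bsub>B\<^esub> \<tau>) X = \<sigma> X \<cdot>\<^bsub>B\<^esub> \<tau> X"
  by (simp add: nt_comp_def)

lemma whisker_left_apply [simp]: "(G \<triangleright> \<tau>) X = amap G (\<tau> X)"
  by (simp add: whisker_left_def)

lemma whisker_right_apply [simp]: "(\<tau> \<triangleleft> F) X = \<tau> (omap F X)"
  by (simp add: whisker_right_def)

lemma nt_id_apply [simp]: "nt_id B F X = Ide B (omap F X)"
  by (simp add: nt_id_def)

lemma nt_inv_apply [simp]: "nt_inv B \<tau> X = inverse_arrow B (\<tau> X)"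
  by (simp add: nt_inv_def)

section \<open>Equational rules for arrows of a category and their inverses\<close>

context category
begin

lemma Obj_Dom_Cod [simp]: "f \<in> Arr A \<Longrightarrow> Dom A f \<in> Obj A" "f \<in> Arr A \<Longrightarrow> Cod A f \<in> Obj A"
  by (simp_all add: Dom_Obj Cod_Obj)

lemma Ide_simps [simp]:
  assumes "X \<in> Obj A"
  shows "Ide A X \<in> Arr A" "Dom A (Ide A X) = X" "Cod A (Ide A X) = X"
  using Ide_Hom[OF assms] by (auto simp: Hom_def)

lemma Comp_simps [simp]:
  assumes "f \<in> Arr A" "g \<in> Arr A" "Dom A g = Cod A f"
  shows "g \<cdot> f \<in> Arr A" "Dom A (g \<cdot> f) = Dom A f" "Cod A (g \<cdot> f) = Cod A g"
  using Comp_Hom[of f "Dom A f" "Cod A f" g "Cod A g"] assms by (auto simp: Hom_def)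

lemma Comp_Ide [simp]:
  "\<lbrakk>f \<in> Arr A; Cod A f = X\<rbrakk> \<Longrightarrow> Ide A X \<cdot> f = f"
  "\<lbrakk>f \<in> Arr A; Dom A f = X\<rbrakk> \<Longrightarrow> f \<cdot> Ide A X = f"
  by (auto intro: Comp_Ide_left Comp_Ide_right simp: Hom_def)

lemma assoc [simp]:
  assumes "f \<in> Arr A" "g \<in> Arr A" "h \<in> Arr A" "Dom A g = Cod A f" "Dom A h = Cod A g"
  shows "h \<cdot> g \<cdot> f = h \<cdot> (g \<cdot> f)"
  using assms by (intro Comp_assoc) (auto simp: Hom_def)

text \<open>
  The simplifier keeps composites associated to the right and functors distributed over them, so
  an equation \<open>g \<cdot> f = h\<close> is also needed with a tail \<open>r\<close> and under functors (\<open>amap_eq\<close> below).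
\<close>

lemma comp_eq_assoc:
  assumes "g \<cdot> f = h" "f \<in> Arr A" "g \<in> Arr A" "Dom A g = Cod A f" "r \<in> Arr A" "Cod A r = Dom A f"
  shows "g \<cdot> (f \<cdot> r) = h \<cdot> r"
  using assms assoc[of r f g] by simp

lemma inverse_arrows_unique:
  assumes "inverse_arrows A f g" "inverse_arrows A f h"
  shows "g = h"
proof -
  have "g = g \<cdot> (f \<cdot> h)"
    using assms by (simp add: inverse_arrows_def Hom_def)
  also have "\<dots> = (g \<cdot> f) \<cdot> h"
    using assms by (subst assoc) (simp_all add: inverse_arrows_def Hom_def)
  also have "\<dots> = h"
    using assms by (simp add: inverse_arrows_def Hom_def)
  finally show ?thesis .
qed

text \<open>Uniqueness of inverses is what makes the definite description in
  \<open>inverse_arrow\<close> denote the inverse.\<close>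

lemma inverse_arrow_inverts: "is_iso A f \<Longrightarrow> inverse_arrows A f (inverse_arrow A f)"
  unfolding is_iso_def inverse_arrow_def
  using theI'[of "inverse_arrows A f"] inverse_arrows_unique by blast

end

context cat_functor
begin

lemma amap_simps [simp]:
  assumes "f \<in> Arr A"
  shows "amap F f \<in> Arr B" "Dom B (amap F f) = omap F (Dom A f)"
    "Cod B (amap F f) = omap F (Cod A f)"
  using amap_Hom[of f "Dom A f" "Cod A f"] assms by (auto simp: Hom_def)

lemma amap_Comp_simp [simp]:
  "\<lbrakk>f \<in> Arr A; g \<in> Arr A; Dom A g = Cod A f\<rbrakk> \<Longrightarrow>
     amap F (g \<cdot>\<^bsub>A\<^esub> f) = amap F g \<cdot>\<^bsub>B\<^esub> amap F f"
  using amap_Comp[of f "Dom A f" "Cod A f" g "Cod A g"] by (simp add: Hom_def)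

lemma amap_eq:
  assumes "g \<cdot>\<^bsub>A\<^esub> f = h" "f \<in> Arr A" "g \<in> Arr A" "Dom A g = Cod A f"
  shows "amap F g \<cdot>\<^bsub>B\<^esub> amap F f = amap F h"
  using assms amap_Comp_simp[of f g] by simp

declare omap_Obj [simp] amap_Ide [simp]

end

section \<open>Closure of functors and natural transformations under composition and
  whiskering\<close>

lemma cat_functor_comp:
  assumes "cat_functor A B F" "cat_functor B C G"
  shows "cat_functor A C (G \<star> F)"
proof -
  interpret F: cat_functor A B F by fact
  interpret G: cat_functor B C G by fact
  show ?thesis by unfold_locales (auto simp: Hom_def)
qed

lemma natural_transformationI:
  assumes "cat_functor A B F" "cat_functor A B G"
    and "\<And>X. X \<in> Obj A \<Longrightarrow> \<tau> X \<in> Arr B \<and> Dom B (\<tau> X) = omap F X \<and> Cod B (\<tau> X) = omap G X"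
    and "\<And>f. f \<in> Arr A \<Longrightarrow> \<tau> (Cod A f) \<cdot>\<^bsub>B\<^esub> amap F f = amap G f \<cdot>\<^bsub>B\<^esub> \<tau> (Dom A f)"
  shows "natural_transformation A B F G \<tau>"
  using assms
  by (auto simp: natural_transformation_def natural_transformation_axioms_def Hom_def)

context natural_transformation
begin

lemma component_simps [simp]:
  assumes "X \<in> Obj A"
  shows "\<tau> X \<in> Arr B" "Dom B (\<tau> X) = omap F X" "Cod B (\<tau> X) = omap G X"
  using component_Hom[OF assms] by (auto simp: Hom_def)

text \<open>The endpoint is a variable \<open>Y\<close> tied to \<open>f\<close> by a premise, so
  the rule also rewrites where the object is not literally written as
  \<open>Cod A f\<close>.\<close>

lemma natural:
  "\<lbrakk>f \<in> Arr A; Cod A f = Y\<rbrakk> \<Longrightarrow> \<tau> Y \<cdot>\<^bsub>B\<^esub> amap F f = amap G f \<cdot>\<^bsub>B\<^esub> \<tau> (Dom A f)"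
  using naturality[of f "Dom A f" "Cod A f"] by (auto simp: Hom_def)

end

lemma natural_transformation_comp:
  assumes "natural_transformation A B F G \<tau>" "natural_transformation A B G H \<sigma>"
  shows "natural_transformation A B F H (\<sigma> \<bullet>\<^bsub>B\<^esub> \<tau>)"
proof -
  interpret \<tau>: natural_transformation A B F G \<tau> by fact
  interpret \<sigma>: natural_transformation A B G H \<sigma> by fact
  show ?thesis
    by (rule natural_transformationI)
      (auto simp: \<tau>.natural \<tau>.dom_functor.target.comp_eq_assoc[OF \<sigma>.natural] intro: \<tau>.dom_functor.cat_functor_axioms \<sigma>.cod_functor.cat_functor_axioms)
qed

lemma natural_transformation_whisker_left:
  assumes "natural_transformation A B F G \<tau>" "cat_functor B C H"
  shows "natural_transformation A C (H \<star> F) (H \<star> G) (H \<triangleright> \<tau>)"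
proof -
  interpret \<tau>: natural_transformation A B F G \<tau> by fact
  interpret H: cat_functor B C H by fact
  have "amap H (\<tau> (Cod A f)) \<cdot>\<^bsub>C\<^esub> amap H (amap F f) = amap H (amap G f) \<cdot>\<^bsub>C\<^esub> amap H (\<tau> (Dom A f))"
    if "f \<in> Arr A" for f
    using arg_cong[OF \<tau>.natural[OF that refl], of "amap H"] that by simp
  then show ?thesis
    by (intro natural_transformationI)
      (auto intro!: cat_functor_comp assms(2) \<tau>.dom_functor.cat_functor_axioms \<tau>.cod_functor.cat_functor_axioms)
qed

lemma natural_transformation_whisker_right:
  assumes "natural_transformation B C G H \<tau>" "cat_functor A B F"
  shows "natural_transformation A C (G \<star> F) (H \<star> F) (\<tau> \<triangleleft> F)"
proof -
  interpret \<tau>: natural_transformation B C G H \<tau> by fact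
  interpret F: cat_functor A B F by fact
  show ?thesis
    by (rule natural_transformationI)
      (auto simp: \<tau>.natural intro: cat_functor_comp assms(2)
        \<tau>.dom_functor.cat_functor_axioms \<tau>.cod_functor.cat_functor_axioms)
qed

section \<open>The inverse of a natural isomorphism\<close>

context natural_isomorphism
begin

lemma inverse_component_simps [simp]:
  assumes "X \<in> Obj A"
  shows "inverse_arrow B (\<tau> X) \<in> Arr B" "Dom B (inverse_arrow B (\<tau> X)) = omap G X"
    "Cod B (inverse_arrow B (\<tau> X)) = omap F X"
    "inverse_arrow B (\<tau> X) \<cdot>\<^bsub>B\<^esub> \<tau> X = Ide B (omap F X)"
    "\<tau> X \<cdot>\<^bsub>B\<^esub> inverse_arrow B (\<tau> X) = Ide B (omap G X)"
  using dom_functor.target.inverse_arrow_inverts[OF component_iso[OF assms]] assms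
  by (auto simp: inverse_arrows_def Hom_def)

lemmas inverse_component_assoc [simp] =
  dom_functor.target.comp_eq_assoc[OF inverse_component_simps(4)]
  dom_functor.target.comp_eq_assoc[OF inverse_component_simps(5)]

lemma natural_transformation_inv: "natural_transformation A B G F (nt_inv B \<tau>)"
proof (rule natural_transformationI)
  fix f assume f: "f \<in> Arr A"
  \<comment> \<open>Inserting \<open>\<tau>\<close> followed on its right by its inverse exposes a
    side of the naturality square of \<open>\<tau>\<close>; once the square is applied, the inverse
    on the left cancels.\<close>
  have "inverse_arrow B (\<tau> (Cod A f)) \<cdot>\<^bsub>B\<^esub> amap G f
      = inverse_arrow B (\<tau> (Cod A f)) \<cdot>\<^bsub>B\<^esub> ((amap G f \<cdot>\<^bsub>B\<^esub> \<tau> (Dom A f)) \<cdot>\<^bsub>B\<^esub> inverse_arrow B (\<tau> (Dom A f)))"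
    using f by simp
  also have "\<dots> = amap F f \<cdot>\<^bsub>B\<^esub> inverse_arrow B (\<tau> (Dom A f))"
    using f by (subst natural[symmetric, OF f refl]) simp
  finally show "nt_inv B \<tau> (Cod A f) \<cdot>\<^bsub>B\<^esub> amap G f = amap F f \<cdot>\<^bsub>B\<^esub> nt_inv B \<tau> (Dom A f)"
    by simp
qed (auto intro: dom_functor.cat_functor_axioms cod_functor.cat_functor_axioms)

end

section \<open>Transposition, and the monad and comonad induced by an adjunction\<close>

context adjunction
begin

lemma triangles [simp]:
  "X \<in> Obj A \<Longrightarrow> \<epsilon> (omap F X) \<cdot>\<^bsub>B\<^esub> amap F (\<eta> X) = Ide B (omap F X)"
  "Y \<in> Obj B \<Longrightarrow> amap U (\<epsilon> Y) \<cdot>\<^bsub>A\<^esub> \<eta> (omap U Y) = Ide A (omap U Y)"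
  using triangle_left triangle_right by (simp_all add: nt_eq_def)

lemmas triangle_images [simp] =
  left.source.comp_eq_assoc[OF triangles(2)]
  right.amap_eq[OF triangles(1)] left.amap_eq[OF triangles(2)]

lemma unit_natural:
  "\<lbrakk>f \<in> Arr A; Dom A f = X\<rbrakk> \<Longrightarrow> amap U (amap F f) \<cdot>\<^bsub>A\<^esub> \<eta> X = \<eta> (Cod A f) \<cdot>\<^bsub>A\<^esub> f"
  using unit.natural[of f "Cod A f"] by simp

lemma counit_natural:
  "\<lbrakk>f \<in> Arr B; Cod B f = Y\<rbrakk> \<Longrightarrow> \<epsilon> Y \<cdot>\<^bsub>B\<^esub> amap F (amap U f) = f \<cdot>\<^bsub>B\<^esub> \<epsilon> (Dom B f)"
  using counit.natural[of f Y] by simp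

text \<open>Transposition is injective because \<open>h\<close> is recovered from
  \<open>U h \<cdot> \<eta>\<close> as \<open>\<epsilon> \<cdot> F (U h \<cdot> \<eta>)\<close>, by
  naturality of \<open>\<epsilon>\<close> and a triangle identity. Later equations between arrows
  out of some \<open>F X\<close> are checked on transposes.\<close>

lemma transpose_cancel:
  assumes "f \<in> Hom B (omap F X) Y" "g \<in> Hom B (omap F X) Y" "X \<in> Obj A"
    and eq: "amap U f \<cdot>\<^bsub>A\<^esub> \<eta> X = amap U g \<cdot>\<^bsub>A\<^esub> \<eta> X"
  shows "f = g"
proof -
  have "\<epsilon> Y \<cdot>\<^bsub>B\<^esub> amap F (amap U h \<cdot>\<^bsub>A\<^esub> \<eta> X) = h" if "h \<in> Hom B (omap F X) Y" for h
    using that assms(3) left.target.Obj_Dom_Cod(2)[of h]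
    by (simp add: Hom_def left.target.comp_eq_assoc[OF counit_natural])
  then show ?thesis
    using assms by metis
qed

text \<open>Associativity is \<open>U\<close> applied to naturality of \<open>\<epsilon>\<close> at
  a component of \<open>\<epsilon> \<triangleleft> F\<close>. The left unit law is the second
  triangle identity at \<open>F X\<close>, the right one is the image under \<open>U\<close> of the
  first.\<close>

lemma induced_monad: "monad A (U \<star> F) (U \<triangleright> \<epsilon> \<triangleleft> F) \<eta>"
proof -
  have M: "cat_functor A A (U \<star> F)"
    by (rule cat_functor_comp[OF left.cat_functor_axioms right.cat_functor_axioms])
  have "natural_transformation A A ((U \<star> F) \<star> (U \<star> F)) (U \<star> F) (U \<triangleright> \<epsilon> \<triangleleft> F)"
    using natural_transformation_whisker_left[OF natural_transformation_whisker_right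
        [OF counit.natural_transformation_axioms left.cat_functor_axioms] right.cat_functor_axioms]
    by (simp add: comp_func_def id_func_def comp_assoc)
  moreover have "(U \<triangleright> \<epsilon> \<triangleleft> F) \<bullet>\<^bsub>A\<^esub> ((U \<star> F) \<triangleright> (U \<triangleright> \<epsilon> \<triangleleft> F)) \<doteq>\<^bsub>A\<^esub>
      (U \<triangleright> \<epsilon> \<triangleleft> F) \<bullet>\<^bsub>A\<^esub> ((U \<triangleright> \<epsilon> \<triangleleft> F) \<triangleleft> (U \<star> F))"
    by (simp add: nt_eq_def right.amap_eq[OF counit_natural])
  moreover have "(U \<triangleright> \<epsilon> \<triangleleft> F) \<bullet>\<^bsub>A\<^esub> (\<eta> \<triangleleft> (U \<star> F)) \<doteq>\<^bsub>A\<^esub> nt_id A (U \<star> F)"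
    by (simp add: nt_eq_def)
  moreover have "(U \<triangleright> \<epsilon> \<triangleleft> F) \<bullet>\<^bsub>A\<^esub> ((U \<star> F) \<triangleright> \<eta>) \<doteq>\<^bsub>A\<^esub> nt_id A (U \<star> F)"
    by (simp add: nt_eq_def)
  ultimately show ?thesis
    using M unit.natural_transformation_axioms by (simp add: monad_def monad_axioms_def)
qed

text \<open>Dually, coassociativity is \<open>F\<close> applied to naturality of
  \<open>\<eta>\<close> at a component of \<open>\<eta> \<triangleleft> U\<close>; the counit laws
  are the first triangle identity at \<open>U Y\<close> and the image under \<open>F\<close> of the
  second.\<close>

lemma induced_comonad: "comonad B (F \<star> U) (F \<triangleright> \<eta> \<triangleleft> U) \<epsilon>"
proof -
  have T: "cat_functor B B (F \<star> U)"
    by (rule cat_functor_comp[OF right.cat_functor_axioms left.cat_functor_axioms])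
  have "natural_transformation B B (F \<star> U) ((F \<star> U) \<star> (F \<star> U)) (F \<triangleright> \<eta> \<triangleleft> U)"
    using natural_transformation_whisker_left[OF natural_transformation_whisker_right
        [OF unit.natural_transformation_axioms right.cat_functor_axioms] left.cat_functor_axioms]
    by (simp add: comp_func_def id_func_def comp_assoc)
  moreover have "((F \<star> U) \<triangleright> (F \<triangleright> \<eta> \<triangleleft> U)) \<bullet>\<^bsub>B\<^esub> (F \<triangleright> \<eta> \<triangleleft> U) \<doteq>\<^bsub>B\<^esub>
      ((F \<triangleright> \<eta> \<triangleleft> U) \<triangleleft> (F \<star> U)) \<bullet>\<^bsub>B\<^esub> (F \<triangleright> \<eta> \<triangleleft> U)"
    by (simp add: nt_eq_def left.amap_eq[OF unit_natural])
  moreover have "(\<epsilon> \<triangleleft> (F \<star> U)) \<bullet>\<^bsub>B\<^esub> (F \<triangleright> \<eta> \<triangleleft> U) \<doteq>\<^bsub>B\<^esub> nt_id B (F \<star> U)"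
    by (simp add: nt_eq_def)
  moreover have "((F \<star> U) \<triangleright> \<epsilon>) \<bullet>\<^bsub>B\<^esub> (F \<triangleright> \<eta> \<triangleleft> U) \<doteq>\<^bsub>B\<^esub> nt_id B (F \<star> U)"
    by (simp add: nt_eq_def)
  ultimately show ?thesis
    using T counit.natural_transformation_axioms by (simp add: comonad_def comonad_axioms_def)
qed

end


section \<open>Lifting along an isomorphism\<close>

locale adjunction_lift =
    adjunction A B F U \<eta> \<epsilon> + over_target: cat_functor B B S + over_source: cat_functor A A C +
    iso: natural_isomorphism B A "C \<star> U" "U \<star> S" \<Omega>
  for A :: "('oa, 'ma) cat" and B :: "('ob, 'mb) cat"
    and F :: "('oa, 'ma, 'ob, 'mb) func" and U :: "('ob, 'mb, 'oa, 'ma) func"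
    and \<eta> :: "'oa \<Rightarrow> 'ma" and \<epsilon> :: "'ob \<Rightarrow> 'mb"
    and S :: "('ob, 'mb, 'ob, 'mb) func" and C :: "('oa, 'ma, 'oa, 'ma) func"
    and \<Omega> :: "'ob \<Rightarrow> 'ma"
begin

abbreviation \<Omega>i :: "'ob \<Rightarrow> 'ma" where
  "\<Omega>i \<equiv> nt_inv A \<Omega>"

text \<open>A definition, while \<open>\<theta>\<close> and \<open>\<chi>\<close> are abbreviations:
  those two are computed on components, whereas \<open>\<Lambda>\<close> stays opaque and enters
  through naturality and \<open>Lambda_unit\<close>.\<close>

definition \<Lambda> :: "'oa \<Rightarrow> 'mb" where
  "\<Lambda> = left_transpose B F \<epsilon> (S \<star> F) ((\<Omega> \<triangleleft> F) \<bullet>\<^bsub>A\<^esub> (C \<triangleright> \<eta>))"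

abbreviation \<theta> :: "'oa \<Rightarrow> 'ma" where
  "\<theta> \<equiv> (\<Omega>i \<triangleleft> F) \<bullet>\<^bsub>A\<^esub> (U \<triangleright> \<Lambda>)"

abbreviation \<chi> :: "'ob \<Rightarrow> 'mb" where
  "\<chi> \<equiv> (\<Lambda> \<triangleleft> U) \<bullet>\<^bsub>B\<^esub> (F \<triangleright> \<Omega>i)"

lemma transposed_natural:
  "natural_transformation A A C (U \<star> (S \<star> F)) ((\<Omega> \<triangleleft> F) \<bullet>\<^bsub>A\<^esub> (C \<triangleright> \<eta>))"
proof (rule natural_transformation_comp)
  show "natural_transformation A A C (C \<star> (U \<star> F)) (C \<triangleright> \<eta>)"
    using natural_transformation_whisker_left[OF unit.natural_transformation_axioms over_source.cat_functor_axioms]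
    by simp
  show "natural_transformation A A (C \<star> (U \<star> F)) (U \<star> (S \<star> F)) (\<Omega> \<triangleleft> F)"
    using natural_transformation_whisker_right[OF iso.natural_transformation_axioms left.cat_functor_axioms]
    by (simp add: comp_func_assoc)
qed

end

sublocale adjunction_lift \<subseteq> Lambda: natural_transformation A B "F \<star> C" "S \<star> F" \<Lambda>
  unfolding \<Lambda>_def
  by (rule left_transpose_correct(1)[OF transposed_natural
        cat_functor_comp[OF left.cat_functor_axioms over_target.cat_functor_axioms]])

context adjunction_lift
begin

lemma Lambda_unit:
  "X \<in> Obj A \<Longrightarrow> amap U (\<Lambda> X) \<cdot>\<^bsub>A\<^esub> \<eta> (omap C X) = \<Omega> (omap F X) \<cdot>\<^bsub>A\<^esub> amap C (\<eta> X)"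
  using left_transpose_correct(2)[OF transposed_natural
      cat_functor_comp[OF left.cat_functor_axioms over_target.cat_functor_axioms]]
  by (simp add: nt_eq_def \<Lambda>_def)

lemma Lambda_natural:
  "\<lbrakk>f \<in> Arr A; Cod A f = Y\<rbrakk> \<Longrightarrow>
    \<Lambda> Y \<cdot>\<^bsub>B\<^esub> amap F (amap C f) = amap S (amap F f) \<cdot>\<^bsub>B\<^esub> \<Lambda> (Dom A f)"
  using Lambda.natural[of f Y] by simp

lemma Omega_natural:
  "\<lbrakk>f \<in> Arr B; Dom B f = X\<rbrakk> \<Longrightarrow>
    amap U (amap S f) \<cdot>\<^bsub>A\<^esub> \<Omega> X = \<Omega> (Cod B f) \<cdot>\<^bsub>A\<^esub> amap C (amap U f)"
  using iso.natural[of f "Cod B f"] by simp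

lemma Omega_inv_natural:
  assumes "f \<in> Arr B" "Dom B f = X"
  shows "amap C (amap U f) \<cdot>\<^bsub>A\<^esub> inverse_arrow A (\<Omega> X)
    = inverse_arrow A (\<Omega> (Cod B f)) \<cdot>\<^bsub>A\<^esub> amap U (amap S f)"
proof -
  interpret inv: natural_transformation B A "U \<star> S" "C \<star> U" \<Omega>i
    by (rule iso.natural_transformation_inv)
  show ?thesis
    using inv.natural[of f "Cod B f"] assms by simp
qed

lemmas Omega_cancel_images [simp] =
  left.amap_eq[OF iso.inverse_component_simps(4)] left.amap_eq[OF iso.inverse_component_simps(5)]
  over_source.amap_eq[OF iso.inverse_component_simps(4)]

text \<open>Both sides have transpose \<open>\<Omega> Y\<close>: on the left by
  \<open>Lambda_unit\<close>, naturality of \<open>\<Omega>\<close> at \<open>\<epsilon> Y\<close>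
  and \<open>C\<close> of a triangle identity, on the right by naturality of \<open>\<eta>\<close>
  and the same triangle identity at \<open>S Y\<close>.\<close>

lemma counit_Lambda:
  assumes "Y \<in> Obj B"
  shows "amap S (\<epsilon> Y) \<cdot>\<^bsub>B\<^esub> \<Lambda> (omap U Y) = \<epsilon> (omap S Y) \<cdot>\<^bsub>B\<^esub> amap F (\<Omega> Y)"
  using assms
  by (intro transpose_cancel[of _ "omap C (omap U Y)" "omap S Y"])
    (simp_all add: Hom_def Lambda_unit unit_natural left.source.comp_eq_assoc[OF Omega_natural]
      over_source.amap_eq[OF triangles(2)])

section \<open>Lax endomorphism axioms and characterizing equations for \<open>\<theta>\<close> and
  \<open>\<chi>\<close>\<close>

lemma theta_natural: "natural_transformation A A ((U \<star> F) \<star> C) (C \<star> (U \<star> F)) \<theta>"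
proof (rule natural_transformation_comp)
  show "natural_transformation A A ((U \<star> F) \<star> C) (U \<star> (S \<star> F)) (U \<triangleright> \<Lambda>)"
    using natural_transformation_whisker_left[OF Lambda.natural_transformation_axioms right.cat_functor_axioms]
    by (simp add: comp_func_assoc)
  show "natural_transformation A A (U \<star> (S \<star> F)) (C \<star> (U \<star> F)) (\<Omega>i \<triangleleft> F)"
    using natural_transformation_whisker_right[OF iso.natural_transformation_inv left.cat_functor_axioms]
    by (simp add: comp_func_assoc)
qed

lemma chi_natural: "natural_transformation B B ((F \<star> U) \<star> S) (S \<star> (F \<star> U)) \<chi>"
proof (rule natural_transformation_comp)
  show "natural_transformation B B ((F \<star> U) \<star> S) (F \<star> (C \<star> U)) (F \<triangleright> \<Omega>i)"
    using natural_transformation_whisker_left[OF iso.natural_transformation_inv left.cat_functor_axioms]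
    by (simp add: comp_func_assoc)
  show "natural_transformation B B (F \<star> (C \<star> U)) (S \<star> (F \<star> U)) (\<Lambda> \<triangleleft> U)"
    using natural_transformation_whisker_right[OF Lambda.natural_transformation_axioms right.cat_functor_axioms]
    by (simp add: comp_func_assoc)
qed

text \<open>Naturality of the inverse of \<open>\<Omega>\<close> moves \<open>C U \<epsilon>\<close>
  past it as \<open>U S \<epsilon>\<close>; then \<open>U\<close> of \<open>counit_Lambda\<close>
  applies.\<close>

lemma theta_counit:
  "(C \<triangleright> U \<triangleright> \<epsilon>) \<bullet>\<^bsub>A\<^esub> (\<theta> \<triangleleft> U) \<doteq>\<^bsub>B\<^esub> \<Omega>i \<bullet>\<^bsub>A\<^esub> (U \<triangleright> \<epsilon> \<triangleleft> S) \<bullet>\<^bsub>A\<^esub> (U \<triangleright> F \<triangleright> \<Omega>)"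
  by (simp add: nt_eq_def left.source.comp_eq_assoc[OF Omega_inv_natural] right.amap_eq[OF counit_Lambda])

lemma theta_lax: "lax_monad_endomorphism A (U \<star> F) (U \<triangleright> \<epsilon> \<triangleleft> F) \<eta> C \<theta>"
proof -
  have "\<theta> \<bullet>\<^bsub>A\<^esub> (\<eta> \<triangleleft> C) \<doteq>\<^bsub>A\<^esub> C \<triangleright> \<eta>"
    by (simp add: nt_eq_def Lambda_unit)
  \<comment> \<open>On the right-hand side, \<open>C U \<epsilon>\<close> again slides past
    \<open>\<Omega>i\<close> and meets \<open>\<Lambda>\<close> in \<open>counit_Lambda\<close>.
    This produces \<open>U F \<Omega>\<close>, which cancels the \<open>U F \<Omega>i\<close> coming
    from the inner \<open>\<theta>\<close>. What remains is naturality of \<open>\<epsilon>\<close>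
    at \<open>\<Lambda> X\<close>, under \<open>U\<close>.\<close>
  moreover have "\<theta> \<bullet>\<^bsub>A\<^esub> ((U \<triangleright> \<epsilon> \<triangleleft> F) \<triangleleft> C)
      \<doteq>\<^bsub>A\<^esub> (C \<triangleright> (U \<triangleright> \<epsilon> \<triangleleft> F)) \<bullet>\<^bsub>A\<^esub> (\<theta> \<triangleleft> (U \<star> F)) \<bullet>\<^bsub>A\<^esub> ((U \<star> F) \<triangleright> \<theta>)"
    by (simp add: nt_eq_def left.source.comp_eq_assoc[OF Omega_inv_natural]
        left.source.comp_eq_assoc[OF right.amap_eq[OF counit_Lambda]]
        left.source.comp_eq_assoc[OF right.amap_eq[OF left.amap_eq[OF iso.inverse_component_simps(5)]]]
        right.amap_eq[OF counit_natural])
  ultimately show ?thesis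
    using induced_monad theta_natural over_source.cat_functor_axioms
    by (simp add: lax_monad_endomorphism_def lax_monad_endomorphism_axioms_def)
qed

text \<open>Naturality of \<open>\<eta>\<close> moves \<open>\<Omega>i\<close> to the far right,
  leaving the transpose of \<open>\<Lambda>\<close>.\<close>

lemma chi_unit:
  "(U \<triangleright> \<chi>) \<bullet>\<^bsub>A\<^esub> (\<eta> \<triangleleft> U \<triangleleft> S) \<doteq>\<^bsub>B\<^esub> (\<Omega> \<triangleleft> F \<triangleleft> U) \<bullet>\<^bsub>A\<^esub> (C \<triangleright> \<eta> \<triangleleft> U) \<bullet>\<^bsub>A\<^esub> \<Omega>i"
  by (simp add: nt_eq_def unit_natural left.source.comp_eq_assoc[OF Lambda_unit])

lemma chi_lax: "lax_comonad_endomorphism B (F \<star> U) (F \<triangleright> \<eta> \<triangleleft> U) \<epsilon> S \<chi>"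
proof -
  have "(S \<triangleright> \<epsilon>) \<bullet>\<^bsub>B\<^esub> \<chi> \<doteq>\<^bsub>B\<^esub> \<epsilon> \<triangleleft> S"
    by (simp add: nt_eq_def left.target.comp_eq_assoc[OF counit_Lambda])
  \<comment> \<open>On the right-hand side, naturality of \<open>\<eta>\<close> brings the inner
    \<open>\<Lambda>\<close> next to the unit; \<open>F\<close> of \<open>Lambda_unit\<close> then
    yields \<open>F \<Omega>\<close>, which cancels the \<open>F \<Omega>i\<close> of the outer
    \<open>\<chi>\<close>. Naturality of \<open>\<Lambda>\<close> at \<open>\<eta> (U Y)\<close>
    gives the left-hand side.\<close>
  moreover have "(S \<triangleright> (F \<triangleright> \<eta> \<triangleleft> U)) \<bullet>\<^bsub>B\<^esub> \<chi>
      \<doteq>\<^bsub>B\<^esub> (\<chi> \<triangleleft> (F \<star> U)) \<bullet>\<^bsub>B\<^esub> ((F \<star> U) \<triangleright> \<chi>) \<bullet>\<^bsub>B\<^esub> ((F \<triangleright> \<eta> \<triangleleft> U) \<triangleleft> S)"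
    by (simp add: nt_eq_def left.amap_eq[OF unit_natural]
        left.target.comp_eq_assoc[OF left.amap_eq[OF Lambda_unit]]
        left.target.comp_eq_assoc[OF Omega_cancel_images(1)]
        left.target.comp_eq_assoc[OF Lambda_natural])
  ultimately show ?thesis
    using induced_comonad chi_natural over_target.cat_functor_axioms
    by (simp add: lax_comonad_endomorphism_def lax_comonad_endomorphism_axioms_def)
qed

section \<open>Uniqueness of \<open>\<theta>\<close> and \<open>\<chi>\<close>\<close>

lemma theta_unique:
  assumes \<theta>1: "natural_transformation A A ((U \<star> F) \<star> C) (C \<star> (U \<star> F)) \<theta>1"
    and \<theta>2: "natural_transformation A A ((U \<star> F) \<star> C) (C \<star> (U \<star> F)) \<theta>2"
    and eq: "(C \<triangleright> U \<triangleright> \<epsilon>) \<bullet>\<^bsub>A\<^esub> (\<theta>1 \<triangleleft> U) \<doteq>\<^bsub>B\<^esub> (C \<triangleright> U \<triangleright> \<epsilon>) \<bullet>\<^bsub>A\<^esub> (\<theta>2 \<triangleleft> U)"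
  shows "\<theta>1 \<doteq>\<^bsub>A\<^esub> \<theta>2"
  unfolding nt_eq_def
proof
  fix X assume X: "X \<in> Obj A"
  \<comment> \<open>Naturality of \<open>\<tau>\<close> at \<open>\<eta> X\<close> turns the last
    two factors into \<open>C U F \<eta> \<cdot> \<tau> X\<close>, and \<open>C U\<close> of a
    triangle identity removes the rest. The first two factors are \<open>eq\<close> evaluated at
    \<open>F X\<close>.\<close>
  have recover: "\<tau> X = amap C (amap U (\<epsilon> (omap F X))) \<cdot>\<^bsub>A\<^esub> \<tau> (omap U (omap F X))
      \<cdot>\<^bsub>A\<^esub> amap U (amap F (amap C (\<eta> X)))"
    if "natural_transformation A A ((U \<star> F) \<star> C) (C \<star> (U \<star> F)) \<tau>" for \<tau>
  proof -
    interpret \<tau>: natural_transformation A A "(U \<star> F) \<star> C" "C \<star> (U \<star> F)" \<tau> by fact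
    show ?thesis
      using X \<tau>.natural[of "\<eta> X", OF _ refl]
      by (simp add: left.source.comp_eq_assoc[OF over_source.amap_eq[OF right.amap_eq[OF triangles(1)]]])
  qed
  show "\<theta>1 X = \<theta>2 X"
    using recover[OF \<theta>1] recover[OF \<theta>2] eq X by (simp add: nt_eq_def)
qed

lemma chi_unique:
  assumes \<chi>1: "natural_transformation B B ((F \<star> U) \<star> S) (S \<star> (F \<star> U)) \<chi>1"
    and \<chi>2: "natural_transformation B B ((F \<star> U) \<star> S) (S \<star> (F \<star> U)) \<chi>2"
    and eq: "(U \<triangleright> \<chi>1) \<bullet>\<^bsub>A\<^esub> (\<eta> \<triangleleft> U \<triangleleft> S) \<doteq>\<^bsub>B\<^esub> (U \<triangleright> \<chi>2) \<bullet>\<^bsub>A\<^esub> (\<eta> \<triangleleft> U \<triangleleft> S)"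
  shows "\<chi>1 \<doteq>\<^bsub>B\<^esub> \<chi>2"
  unfolding nt_eq_def
proof
  interpret c1: natural_transformation B B "(F \<star> U) \<star> S" "S \<star> (F \<star> U)" \<chi>1 by (rule \<chi>1)
  interpret c2: natural_transformation B B "(F \<star> U) \<star> S" "S \<star> (F \<star> U)" \<chi>2 by (rule \<chi>2)
  fix Y assume "Y \<in> Obj B"
  then show "\<chi>1 Y = \<chi>2 Y"
    using eq by (intro transpose_cancel[of _ "omap U (omap S Y)" "omap S (omap F (omap U Y))"])
      (simp_all add: Hom_def nt_eq_def)
qed

end

section \<open>Distributive laws\<close>

locale comonad_lift = adjunction_lift A B F U \<eta> \<epsilon> S C \<Omega> +
    morphism: lax_comonad_morphism A C \<Delta>C \<epsilon>C B S \<Delta>S \<epsilon>S U \<Omega>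
  for A :: "('oa, 'ma) cat" and B :: "('ob, 'mb) cat"
    and F :: "('oa, 'ma, 'ob, 'mb) func" and U :: "('ob, 'mb, 'oa, 'ma) func"
    and \<eta> :: "'oa \<Rightarrow> 'ma" and \<epsilon> :: "'ob \<Rightarrow> 'mb"
    and S :: "('ob, 'mb, 'ob, 'mb) func" and C :: "('oa, 'ma, 'oa, 'ma) func"
    and \<Omega> :: "'ob \<Rightarrow> 'ma" and \<Delta>C \<epsilon>C :: "'oa \<Rightarrow> 'ma" and \<Delta>S \<epsilon>S :: "'ob \<Rightarrow> 'mb"
begin

lemma Omega_counit:
  "Y \<in> Obj B \<Longrightarrow> amap U (\<epsilon>S Y) \<cdot>\<^bsub>A\<^esub> \<Omega> Y = \<epsilon>C (omap U Y)"
  using morphism.morphism_counit by (simp add: nt_eq_def)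

lemma Omega_comult:
  "Y \<in> Obj B \<Longrightarrow>
    amap U (\<Delta>S Y) \<cdot>\<^bsub>A\<^esub> \<Omega> Y = \<Omega> (omap S Y) \<cdot>\<^bsub>A\<^esub> (amap C (\<Omega> Y) \<cdot>\<^bsub>A\<^esub> \<Delta>C (omap U Y))"
  using morphism.morphism_comult by (simp add: nt_eq_def)

lemma counit_natural_C:
  "\<lbrakk>f \<in> Arr A; Cod A f = Y\<rbrakk> \<Longrightarrow> \<epsilon>C Y \<cdot>\<^bsub>A\<^esub> amap C f = f \<cdot>\<^bsub>A\<^esub> \<epsilon>C (Dom A f)"
  using morphism.source.counit.natural[of f Y] by simp

lemma comult_natural_C:
  "\<lbrakk>f \<in> Arr A; Cod A f = Y\<rbrakk> \<Longrightarrow> \<Delta>C Y \<cdot>\<^bsub>A\<^esub> amap C f = amap C (amap C f) \<cdot>\<^bsub>A\<^esub> \<Delta>C (Dom A f)"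
  using morphism.source.comult.natural[of f Y] by simp

lemma Omega_inv_counit:
  assumes "Y \<in> Obj B"
  shows "\<epsilon>C (omap U Y) \<cdot>\<^bsub>A\<^esub> inverse_arrow A (\<Omega> Y) = amap U (\<epsilon>S Y)"
  using assms by (simp add: Omega_counit[symmetric])

text \<open>The comultiplication axiom is composed with the inverse of \<open>\<Omega> Y\<close> on
  the right; then \<open>\<Omega> (S Y)\<close> and \<open>C (\<Omega> Y)\<close> are cancelled on
  the left.\<close>

lemma Omega_inv_comult:
  assumes "Y \<in> Obj B"
  shows "\<Delta>C (omap U Y) \<cdot>\<^bsub>A\<^esub> inverse_arrow A (\<Omega> Y)
    = amap C (inverse_arrow A (\<Omega> Y)) \<cdot>\<^bsub>A\<^esub> (inverse_arrow A (\<Omega> (omap S Y)) \<cdot>\<^bsub>A\<^esub> amap U (\<Delta>S Y))"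
proof -
  have "amap U (\<Delta>S Y) = \<Omega> (omap S Y) \<cdot>\<^bsub>A\<^esub> (amap C (\<Omega> Y) \<cdot>\<^bsub>A\<^esub>
      (\<Delta>C (omap U Y) \<cdot>\<^bsub>A\<^esub> inverse_arrow A (\<Omega> Y)))"
    using left.source.comp_eq_assoc[OF Omega_comult, of Y "inverse_arrow A (\<Omega> Y)"] assms by simp
  then show ?thesis
    using assms by (simp add: left.source.comp_eq_assoc[OF Omega_cancel_images(3)])
qed

text \<open>Both transposes are \<open>\<eta> X \<cdot> \<epsilon>C X\<close>; on the left this uses
  the counit axiom of \<open>\<Omega>\<close> at \<open>F X\<close> and naturality of
  \<open>\<epsilon>C\<close> at \<open>\<eta> X\<close>.\<close>

lemma counit_Lambda_comonad:
  "X \<in> Obj A \<Longrightarrow> \<epsilon>S (omap F X) \<cdot>\<^bsub>B\<^esub> \<Lambda> X = amap F (\<epsilon>C X)"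
  by (rule transpose_cancel[of _ "omap C X" "omap F X"])
    (simp_all add: Hom_def Lambda_unit unit_natural left.source.comp_eq_assoc[OF Omega_counit] counit_natural_C)

text \<open>Both transposes are \<open>\<Omega> (S (F X)) \<cdot> C (\<Omega> (F X)) \<cdot> C (C
  (\<eta> X)) \<cdot> \<Delta>C X\<close>. The left side reaches it by the comultiplication axiom of
  \<open>\<Omega>\<close>; the right side uses \<open>Lambda_unit\<close> twice, with naturality of
  \<open>\<Omega>\<close> at \<open>\<Lambda> X\<close> in between.\<close>

lemma comult_Lambda:
  "X \<in> Obj A \<Longrightarrow>
    \<Delta>S (omap F X) \<cdot>\<^bsub>B\<^esub> \<Lambda> X = amap S (\<Lambda> X) \<cdot>\<^bsub>B\<^esub> (\<Lambda> (omap C X) \<cdot>\<^bsub>B\<^esub> amap F (\<Delta>C X))"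
  by (rule transpose_cancel[of _ "omap C X" "omap S (omap S (omap F X))"])
    (simp_all add: Hom_def Lambda_unit unit_natural left.source.comp_eq_assoc[OF Omega_comult]
      comult_natural_C left.source.comp_eq_assoc[OF Lambda_unit]
      left.source.comp_eq_assoc[OF Omega_natural]
      left.source.comp_eq_assoc[OF over_source.amap_eq[OF Lambda_unit]])

lemma theta_distributive:
  "mixed_distributive_law A (U \<star> F) (U \<triangleright> \<epsilon> \<triangleleft> F) \<eta> C \<Delta>C \<epsilon>C \<theta>"
proof -
  have "(\<epsilon>C \<triangleleft> (U \<star> F)) \<bullet>\<^bsub>A\<^esub> \<theta> \<doteq>\<^bsub>A\<^esub> (U \<star> F) \<triangleright> \<epsilon>C"
    by (simp add: nt_eq_def left.source.comp_eq_assoc[OF Omega_inv_counit]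
        right.amap_eq[OF counit_Lambda_comonad])
  \<comment> \<open>\<open>\<Delta>C\<close> passes the inverse of \<open>\<Omega>\<close> and
    becomes \<open>\<Delta>S\<close>, which passes \<open>\<Lambda>\<close> by
    \<open>comult_Lambda\<close>. Naturality of \<open>\<Omega>i\<close> at
    \<open>\<Lambda> X\<close> interleaves the factors into two copies of
    \<open>\<theta>\<close>.\<close>
  moreover have "(\<Delta>C \<triangleleft> (U \<star> F)) \<bullet>\<^bsub>A\<^esub> \<theta> \<doteq>\<^bsub>A\<^esub> (C \<triangleright> \<theta>) \<bullet>\<^bsub>A\<^esub> (\<theta> \<triangleleft> C) \<bullet>\<^bsub>A\<^esub> ((U \<star> F) \<triangleright> \<Delta>C)"
    by (simp add: nt_eq_def left.source.comp_eq_assoc[OF Omega_inv_comult]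
        right.amap_eq[OF comult_Lambda] left.source.comp_eq_assoc[OF Omega_inv_natural])
  ultimately show ?thesis
    using theta_lax morphism.source.comonad_axioms
    by (simp add: mixed_distributive_law_def mixed_distributive_law_axioms_def)
qed

lemma chi_distributive:
  "comonad_distributive_law B (F \<star> U) (F \<triangleright> \<eta> \<triangleleft> U) \<epsilon> S \<Delta>S \<epsilon>S \<chi>"
proof -
  have "(\<epsilon>S \<triangleleft> (F \<star> U)) \<bullet>\<^bsub>B\<^esub> \<chi> \<doteq>\<^bsub>B\<^esub> (F \<star> U) \<triangleright> \<epsilon>S"
    by (simp add: nt_eq_def left.target.comp_eq_assoc[OF counit_Lambda_comonad]
        left.amap_eq[OF Omega_inv_counit])
  \<comment> \<open>Here the order is reversed: \<open>\<Delta>S\<close> first passes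
    \<open>\<Lambda>\<close> and becomes \<open>\<Delta>C\<close>, which then passes the inverse of
    \<open>\<Omega>\<close>. Naturality of \<open>\<Lambda>\<close> at the inverse of
    \<open>\<Omega> Y\<close> regroups the factors into two copies of \<open>\<chi>\<close>.\<close>
  moreover have "(\<Delta>S \<triangleleft> (F \<star> U)) \<bullet>\<^bsub>B\<^esub> \<chi> \<doteq>\<^bsub>B\<^esub> (S \<triangleright> \<chi>) \<bullet>\<^bsub>B\<^esub> (\<chi> \<triangleleft> S) \<bullet>\<^bsub>B\<^esub> ((F \<star> U) \<triangleright> \<Delta>S)"
    by (simp add: nt_eq_def left.target.comp_eq_assoc[OF comult_Lambda]
        left.amap_eq[OF Omega_inv_comult] left.target.comp_eq_assoc[OF Lambda_natural])
  ultimately show ?thesis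
    using chi_lax morphism.target.comonad_axioms
    by (simp add: comonad_distributive_law_def comonad_distributive_law_axioms_def)
qed

end

theorem theorem2p5:
  fixes A :: "('oa, 'ma) cat" and B :: "('ob, 'mb) cat"
    and F :: "('oa, 'ma, 'ob, 'mb) func" and U :: "('ob, 'mb, 'oa, 'ma) func"
    and \<eta> :: "'oa \<Rightarrow> 'ma" and \<epsilon> :: "'ob \<Rightarrow> 'mb"
    and S :: "('ob, 'mb, 'ob, 'mb) func" and C :: "('oa, 'ma, 'oa, 'ma) func"
    and \<Omega> :: "'ob \<Rightarrow> 'ma"
  assumes adj: "adjunction A B F U \<eta> \<epsilon>"
    and S: "cat_functor B B S"
    and C: "cat_functor A A C"
    and \<Omega>: "natural_isomorphism B A (C \<star> U) (U \<star> S) \<Omega>"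
  defines "M \<equiv> U \<star> F" and "\<mu> \<equiv> U \<triangleright> \<epsilon> \<triangleleft> F"
    and "T \<equiv> F \<star> U" and "\<Delta> \<equiv> F \<triangleright> \<eta> \<triangleleft> U"
    and "\<Omega>i \<equiv> nt_inv A \<Omega>"
    and "\<Lambda> \<equiv> left_transpose B F \<epsilon> (S \<star> F) ((\<Omega> \<triangleleft> F) \<bullet>\<^bsub>A\<^esub> (C \<triangleright> \<eta>))"
  defines "\<theta> \<equiv> (\<Omega>i \<triangleleft> F) \<bullet>\<^bsub>A\<^esub> (U \<triangleright> \<Lambda>)"
    and "\<chi> \<equiv> (\<Lambda> \<triangleleft> U) \<bullet>\<^bsub>B\<^esub> (F \<triangleright> \<Omega>i)"
  shows "lax_monad_endomorphism A M \<mu> \<eta> C \<theta> \<and>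
     lax_comonad_endomorphism B T \<Delta> \<epsilon> S \<chi> \<and>
     ((C \<triangleright> U \<triangleright> \<epsilon>) \<bullet>\<^bsub>A\<^esub> (\<theta> \<triangleleft> U)
         \<doteq>\<^bsub>B\<^esub> \<Omega>i \<bullet>\<^bsub>A\<^esub> (U \<triangleright> \<epsilon> \<triangleleft> S) \<bullet>\<^bsub>A\<^esub> (U \<triangleright> F \<triangleright> \<Omega>) \<and>
       (\<forall>\<theta>'. lax_monad_endomorphism A M \<mu> \<eta> C \<theta>' \<and>
             (C \<triangleright> U \<triangleright> \<epsilon>) \<bullet>\<^bsub>A\<^esub> (\<theta>' \<triangleleft> U)
               \<doteq>\<^bsub>B\<^esub> \<Omega>i \<bullet>\<^bsub>A\<^esub> (U \<triangleright> \<epsilon> \<triangleleft> S) \<bullet>\<^bsub>A\<^esub> (U \<triangleright> F \<triangleright> \<Omega>)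
             \<longrightarrow> \<theta>' \<doteq>\<^bsub>A\<^esub> \<theta>)) \<and>
     ((U \<triangleright> \<chi>) \<bullet>\<^bsub>A\<^esub> (\<eta> \<triangleleft> U \<triangleleft> S)
         \<doteq>\<^bsub>B\<^esub> (\<Omega> \<triangleleft> F \<triangleleft> U) \<bullet>\<^bsub>A\<^esub> (C \<triangleright> \<eta> \<triangleleft> U) \<bullet>\<^bsub>A\<^esub> \<Omega>i \<and>
       (\<forall>\<chi>'. lax_comonad_endomorphism B T \<Delta> \<epsilon> S \<chi>' \<and>
             (U \<triangleright> \<chi>') \<bullet>\<^bsub>A\<^esub> (\<eta> \<triangleleft> U \<triangleleft> S)
               \<doteq>\<^bsub>B\<^esub> (\<Omega> \<triangleleft> F \<triangleleft> U) \<bullet>\<^bsub>A\<^esub> (C \<triangleright> \<eta> \<triangleleft> U) \<bullet>\<^bsub>A\<^esub> \<Omega>i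
             \<longrightarrow> \<chi>' \<doteq>\<^bsub>B\<^esub> \<chi>)) \<and>
     (\<forall>\<Delta>C \<epsilon>C \<Delta>S \<epsilon>S.
         comonad A C \<Delta>C \<epsilon>C \<and> comonad B S \<Delta>S \<epsilon>S \<and>
         lax_comonad_morphism A C \<Delta>C \<epsilon>C B S \<Delta>S \<epsilon>S U \<Omega> \<longrightarrow>
         mixed_distributive_law A M \<mu> \<eta> C \<Delta>C \<epsilon>C \<theta> \<and>
         comonad_distributive_law B T \<Delta> \<epsilon> S \<Delta>S \<epsilon>S \<chi>)"
proof -
  interpret L: adjunction_lift A B F U \<eta> \<epsilon> S C \<Omega>
    using adj S C \<Omega> by (simp add: adjunction_lift_def)
  have \<theta>: "\<theta> = L.\<theta>" and \<chi>: "\<chi> = L.\<chi>"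
    by (simp_all add: \<theta>_def \<chi>_def \<Omega>i_def \<Lambda>_def L.\<Lambda>_def)
  have distributive: "mixed_distributive_law A (U \<star> F) (U \<triangleright> \<epsilon> \<triangleleft> F) \<eta> C \<Delta>C \<epsilon>C L.\<theta> \<and>
      comonad_distributive_law B (F \<star> U) (F \<triangleright> \<eta> \<triangleleft> U) \<epsilon> S \<Delta>S \<epsilon>S L.\<chi>"
    if "lax_comonad_morphism A C \<Delta>C \<epsilon>C B S \<Delta>S \<epsilon>S U \<Omega>" for \<Delta>C \<epsilon>C \<Delta>S \<epsilon>S
  proof -
    \<comment> \<open>The comonad structures are quantified inside claim (5), so this interpretation
      is made for each choice of them.\<close>
    interpret comonad_lift A B F U \<eta> \<epsilon> S C \<Omega> \<Delta>C \<epsilon>C \<Delta>S \<epsilon>S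
      using that L.adjunction_lift_axioms by (simp add: comonad_lift_def)
    show ?thesis
      using theta_distributive chi_distributive by blast
  qed
  have \<theta>_unique: "\<theta>' \<doteq>\<^bsub>A\<^esub> L.\<theta>"
    if "lax_monad_endomorphism A (U \<star> F) (U \<triangleright> \<epsilon> \<triangleleft> F) \<eta> C \<theta>'"
      and "(C \<triangleright> U \<triangleright> \<epsilon>) \<bullet>\<^bsub>A\<^esub> (\<theta>' \<triangleleft> U)
        \<doteq>\<^bsub>B\<^esub> nt_inv A \<Omega> \<bullet>\<^bsub>A\<^esub> (U \<triangleright> \<epsilon> \<triangleleft> S) \<bullet>\<^bsub>A\<^esub> (U \<triangleright> F \<triangleright> \<Omega>)" for \<theta>'
    \<comment> \<open>\<open>\<theta>'\<close> and \<open>L.\<theta>\<close> have the same composite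
      with \<open>C U \<epsilon>\<close>, as both satisfy the equation of (3).\<close>
    using that L.theta_counit
    by (intro L.theta_unique[OF _ L.theta_natural]) (simp_all add: lax_monad_endomorphism_def nt_eq_def)
  have \<chi>_unique: "\<chi>' \<doteq>\<^bsub>B\<^esub> L.\<chi>"
    if "lax_comonad_endomorphism B (F \<star> U) (F \<triangleright> \<eta> \<triangleleft> U) \<epsilon> S \<chi>'"
      and "(U \<triangleright> \<chi>') \<bullet>\<^bsub>A\<^esub> (\<eta> \<triangleleft> U \<triangleleft> S)
        \<doteq>\<^bsub>B\<^esub> (\<Omega> \<triangleleft> F \<triangleleft> U) \<bullet>\<^bsub>A\<^esub> (C \<triangleright> \<eta> \<triangleleft> U) \<bullet>\<^bsub>A\<^esub> nt_inv A \<Omega>" for \<chi>'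
    using that L.chi_unit
    by (intro L.chi_unique[OF _ L.chi_natural]) (simp_all add: lax_comonad_endomorphism_def nt_eq_def)
  show ?thesis
    unfolding \<theta> \<chi> M_def \<mu>_def T_def \<Delta>_def \<Omega>i_def
    using L.theta_lax L.chi_lax L.theta_counit L.chi_unit \<theta>_unique \<chi>_unique distributive by blast
qed

end
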